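(* Let $f:\{0,1\}^4\to\mathbb{R}$ be submodular with polynomial representation $f(x_1,\dots,x_4)=\sum_{I\subseteq\{1,2,3,4\}}a_I\prod_{i\in I}x_i$. Then $f$ is expressible by $\Gamma_{\mathsf{sub},2}$ if and only if $f$ satisfies condition Sep: for all distinct $i,j,k,l\in\{1,2,3,4\}$, $a_{\{i,j\}}+a_{\{k,l\}}+a_{\{i,j,k\}}+a_{\{i,j,l\}}\le0$.
   Context: Every function $\{0,1\}^n\to\mathbb{R}$ has a unique representation as a multilinear polynomial $\sum_I a_I\prod_{i\in I}x_i$. A function $\phi:\{0,1\}^n\to\mathbb{R}$ is submodular if $\phi(\min(u,v))+\phi(\max(u,v))\le\phi(u)+\phi(v)$ for all $u,v$ (coordinatewise min/max). $\Gamma_{\mathsf{sub},2}$ is the set of real-valued submodular functions on $\{0,1\}$ of arity at most 2. $f$ is expressible by $\Gamma_{\mathsf{sub},2}$ if $f(x)=\min_{y_1,\dots,y_j\in\{0,1\}}\phi'(x,y)+\kappa$ for some $j\ge0$, constant $\kappa$, and $\phi'$ a nonnegative linear combination of functions from $\Gamma_{\mathsf{sub},2}$ each applied to some of the variables $x_1,\dots,x_4,y_1,\dots,y_j$. *)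

theory Defs
  imports Complex_Main
begin

text \<open>
  The cube $\{0,1\}^n$ is the set of Boolean lists of length $n$, with \<open>False < True\<close>
  standing for $0 < 1$; a function on it is a function on lists whose values at other lengths
  are irrelevant. Coordinates are numbered from 0, so the variables $x_1, \dots, x_n$ are
  \<open>x ! 0\<close>, \dots, \<open>x ! (n - 1)\<close>.
\<close>

definition cube :: "nat \<Rightarrow> bool list set" where
  "cube n = {x. length x = n}"

definition submodular :: "nat \<Rightarrow> (bool list \<Rightarrow> real) \<Rightarrow> bool" where
  "submodular n \<phi> \<longleftrightarrow>
     (\<forall>u\<in>cube n. \<forall>v\<in>cube n. \<phi> (map2 min u v) + \<phi> (map2 max u v) \<le> \<phi> u + \<phi> v)"

definition polynomial_representation ::
    "nat \<Rightarrow> (nat set \<Rightarrow> real) \<Rightarrow> (bool list \<Rightarrow> real) \<Rightarrow> bool" where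
  "polynomial_representation n a f \<longleftrightarrow>
     (\<forall>x\<in>cube n. f x = (\<Sum>I\<in>Pow {..<n}. a I * (\<Prod>i\<in>I. of_bool (x ! i))))"

text \<open>A set of functions of various arities is a set of pairs (arity, function).\<close>

definition Gamma_sub2 :: "(nat \<times> (bool list \<Rightarrow> real)) set" where
  "Gamma_sub2 = {(m, \<phi>). m \<le> 2 \<and> submodular m \<phi>}"

text \<open>
  The \<open>t\<close>-th summand applies \<open>g t\<close> to the variables listed in the scope \<open>s t\<close>; as usual for
  valued constraints, a scope may repeat a variable.
\<close>

definition nonneg_combination ::
    "(nat \<times> (bool list \<Rightarrow> real)) set \<Rightarrow> nat \<Rightarrow> (bool list \<Rightarrow> real) \<Rightarrow> bool" where
  "nonneg_combination \<Gamma> n \<phi> \<longleftrightarrow>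
     (\<exists>(N :: nat) (c :: nat \<Rightarrow> real) (g :: nat \<Rightarrow> bool list \<Rightarrow> real) (s :: nat \<Rightarrow> nat list).
        (\<forall>t<N. 0 \<le> c t \<and> (length (s t), g t) \<in> \<Gamma> \<and> set (s t) \<subseteq> {..<n}) \<and>
        (\<forall>z\<in>cube n. \<phi> z = (\<Sum>t<N. c t * g t (map ((!) z) (s t)))))"

definition expressible ::
    "(nat \<times> (bool list \<Rightarrow> real)) set \<Rightarrow> nat \<Rightarrow> (bool list \<Rightarrow> real) \<Rightarrow> bool" where
  "expressible \<Gamma> n f \<longleftrightarrow>
     (\<exists>(j :: nat) (\<kappa> :: real) (\<phi> :: bool list \<Rightarrow> real).
        nonneg_combination \<Gamma> (n + j) \<phi> \<and>
        (\<forall>x\<in>cube n. f x = Min ((\<lambda>y. \<phi> (x @ y)) ` cube j) + \<kappa>))"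

definition Sep :: "(nat set \<Rightarrow> real) \<Rightarrow> bool" where
  "Sep a \<longleftrightarrow>
     (\<forall>i\<in>{..<4}. \<forall>j\<in>{..<4}. \<forall>k\<in>{..<4}. \<forall>l\<in>{..<4}. distinct [i, j, k, l] \<longrightarrow>
        a {i, j} + a {k, l} + a {i, j, k} + a {i, j, l} \<le> 0)"

text \<open>The minimum in \<open>expressible\<close> is over a finite nonempty set.\<close>

lemma finite_cube: "finite (cube n)"
  using finite_lists_length_eq[of "UNIV :: bool set" n] by (simp add: cube_def)

lemma cube_nonempty: "cube n \<noteq> {}"
  unfolding cube_def using length_replicate[of n False] by blast

end

theory Submission
  imports Defs
begin

text \<open>
  Necessity: the separation inequality says that \<open>f\<close> does not increase in total when the five sets
  \<open>ij, ik, jk, il, jl\<close> are replaced by \<open>ijk, ijl, i, j, kl\<close>. This replacement extends to a monotone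
  map of \<open>{0,1}\<^sup>5\<close> into itself that preserves weights. A monotone weight-preserving map does not
  decrease inner products, hence does not increase totals of binary submodular functions, these
  being modular up to a term \<open>- t x y\<close> with \<open>t \<ge> 0\<close>; applied to minimising values of the hidden
  variables it yields the inequality for every expressible \<open>f\<close>.

  Sufficiency: modular functions and products \<open>- x y\<close> are expressible, so it is enough to reach the
  cubic and quartic coefficients of \<open>f\<close> with pair coefficients that are not too low. If the quartic
  coefficient is at most 0, then thresholds \<open>- max 0 (\<Sum> x - m)\<close> on triples and on all variables
  suffice. If it is at least 0, separation follows from submodularity, and the least admissible pair
  coefficients are piecewise linear in the higher ones; a layer-cake decomposition reduces \<open>f\<close> to
  functions expressible with at most two hidden variables.
\<close>

section \<open>Nonnegative combinations\<close>

lemma nonneg_combination_cong: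
  assumes "nonneg_combination \<Gamma> n \<phi>" and "\<And>z. z \<in> cube n \<Longrightarrow> \<psi> z = \<phi> z"
  shows "nonneg_combination \<Gamma> n \<psi>"
  using assms unfolding nonneg_combination_def by simp

lemma nonneg_combination_zero: "nonneg_combination \<Gamma> n (\<lambda>z. 0)"
  unfolding nonneg_combination_def by (rule exI[of _ 0]) simp

lemma nonneg_combination_insert:
  assumes "nonneg_combination \<Gamma> n \<psi>"
    and "0 \<le> r" and "(length p, h) \<in> \<Gamma>" and "set p \<subseteq> {..<n}"
  shows "nonneg_combination \<Gamma> n (\<lambda>z. \<psi> z + r * h (map ((!) z) p))"
proof -
  obtain N :: nat and c g s
    where terms: "\<forall>t<N. 0 \<le> c t \<and> (length (s t), g t) \<in> \<Gamma> \<and> set (s t) \<subseteq> {..<n}"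
      and \<psi>: "\<forall>z\<in>cube n. \<psi> z = (\<Sum>t<N. c t * g t (map ((!) z) (s t)))"
    using assms(1) unfolding nonneg_combination_def by blast
  let ?c = "c(N := r)" and ?g = "g(N := h)" and ?s = "s(N := p)"
  have "\<forall>t<Suc N. 0 \<le> ?c t \<and> (length (?s t), ?g t) \<in> \<Gamma> \<and> set (?s t) \<subseteq> {..<n}"
    using terms assms(2-4) by (simp add: less_Suc_eq)
  moreover have "\<forall>z\<in>cube n. \<psi> z + r * h (map ((!) z) p)
      = (\<Sum>t<Suc N. ?c t * ?g t (map ((!) z) (?s t)))"
    using \<psi> by simp
  ultimately show ?thesis
    unfolding nonneg_combination_def by blast
qed

lemma nonneg_combination_induct [consumes 1, case_names cong zero insert]:
  assumes "nonneg_combination \<Gamma> n \<phi>"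
    and cong: "\<And>\<phi> \<psi>. P \<phi> \<Longrightarrow> (\<And>z. z \<in> cube n \<Longrightarrow> \<psi> z = \<phi> z) \<Longrightarrow> P \<psi>"
    and zero: "P (\<lambda>z. 0)"
    and insert: "\<And>r s g \<psi>. 0 \<le> r \<Longrightarrow> (length s, g) \<in> \<Gamma> \<Longrightarrow> set s \<subseteq> {..<n} \<Longrightarrow> P \<psi> \<Longrightarrow>
      P (\<lambda>z. \<psi> z + r * g (map ((!) z) s))"
  shows "P \<phi>"
proof -
  obtain N :: nat and c g s
    where terms: "\<forall>t<N. 0 \<le> c t \<and> (length (s t), g t) \<in> \<Gamma> \<and> set (s t) \<subseteq> {..<n}"
      and \<phi>: "\<forall>z\<in>cube n. \<phi> z = (\<Sum>t<N. c t * g t (map ((!) z) (s t)))"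
    using assms(1) unfolding nonneg_combination_def by blast
  have "P (\<lambda>z. \<Sum>t<M. c t * g t (map ((!) z) (s t)))" if "M \<le> N" for M
    using that
  proof (induction M)
    case 0
    show ?case by (simp add: zero)
  next
    case (Suc M)
    then show ?case
      using insert[of "c M" "s M" "g M"] terms by simp
  qed
  then show ?thesis
    using cong \<phi> by blast
qed

lemma nonneg_combination_add:
  assumes "nonneg_combination \<Gamma> n \<phi>" and "nonneg_combination \<Gamma> n \<psi>"
  shows "nonneg_combination \<Gamma> n (\<lambda>z. \<phi> z + \<psi> z)"
  using assms(1)
proof (induction rule: nonneg_combination_induct)
  case (cong \<phi> \<phi>')
  from cong(1) show ?case
    by (rule nonneg_combination_cong) (simp add: cong(2))
next
  case zero
  show ?case using assms(2) by simp
next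
  case (insert r s g \<phi>)
  then show ?case
    using nonneg_combination_insert[OF insert(4,1,2,3)] by (simp add: add_ac)
qed

lemma nonneg_combination_sum:
  assumes "finite K" and "\<And>k. k \<in> K \<Longrightarrow> nonneg_combination \<Gamma> n (\<phi> k)"
  shows "nonneg_combination \<Gamma> n (\<lambda>z. \<Sum>k\<in>K. \<phi> k z)"
  using assms by (induction K) (simp_all add: nonneg_combination_zero nonneg_combination_add)

lemma nonneg_combination_scale:
  assumes "nonneg_combination \<Gamma> n \<phi>" and "0 \<le> r"
  shows "nonneg_combination \<Gamma> n (\<lambda>z. r * \<phi> z)"
  using assms(1)
proof (induction rule: nonneg_combination_induct)
  case (cong \<phi> \<phi>')
  from cong(1) show ?case
    by (rule nonneg_combination_cong) (simp add: cong(2))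
next
  case zero
  show ?case by (simp add: nonneg_combination_zero)
next
  case (insert c s g \<phi>)
  then show ?case
    using nonneg_combination_insert[OF insert(4) _ insert(2,3), of "r * c"] assms(2)
    by (simp add: algebra_simps)
qed

lemma nonneg_combination_reindex:
  assumes "nonneg_combination \<Gamma> n \<phi>" and \<rho>: "\<And>i. i < n \<Longrightarrow> \<rho> i < m"
  shows "nonneg_combination \<Gamma> m (\<lambda>z. \<phi> (map (\<lambda>i. z ! \<rho> i) [0..<n]))"
  using assms(1)
proof (induction rule: nonneg_combination_induct)
  case (cong \<phi> \<phi>')
  from cong(1) show ?case
    by (rule nonneg_combination_cong) (simp add: cong(2) cube_def)
next
  case zero
  show ?case by (rule nonneg_combination_zero)
next
  case (insert c s g \<phi>)
  have "map ((!) (map (\<lambda>i. z ! \<rho> i) [0..<n])) s = map ((!) z) (map \<rho> s)" for z :: "bool list"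
    using insert(3) by (auto simp: subset_eq)
  moreover have "set (map \<rho> s) \<subseteq> {..<m}"
    using insert(3) \<rho> by (auto simp: subset_eq)
  ultimately show ?case
    using nonneg_combination_insert[OF insert(4,1), of "map \<rho> s" g] insert(2) by (simp del: map_map)
qed

section \<open>Expressibility\<close>

lemma append_in_cube: "x \<in> cube n \<Longrightarrow> y \<in> cube m \<Longrightarrow> x @ y \<in> cube (n + m)"
  by (simp add: cube_def)

lemma expressible_iff_attained:
  "expressible \<Gamma> n f \<longleftrightarrow>
     (\<exists>j \<kappa> \<phi>. nonneg_combination \<Gamma> (n + j) \<phi> \<and>
        (\<forall>x\<in>cube n. (\<exists>y\<in>cube j. f x = \<phi> (x @ y) + \<kappa>) \<and> (\<forall>y\<in>cube j. f x \<le> \<phi> (x @ y) + \<kappa>)))"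
proof -
  have "f x = Min ((\<lambda>y. \<phi> (x @ y)) ` cube j) + \<kappa> \<longleftrightarrow>
      (\<exists>y\<in>cube j. f x = \<phi> (x @ y) + \<kappa>) \<and> (\<forall>y\<in>cube j. f x \<le> \<phi> (x @ y) + \<kappa>)"
    for x \<phi> j and \<kappa> :: real
  proof -
    have "f x = Min ((\<lambda>y. \<phi> (x @ y)) ` cube j) + \<kappa> \<longleftrightarrow>
        Min ((\<lambda>y. \<phi> (x @ y)) ` cube j) = f x - \<kappa>"
      by auto
    also have "\<dots> \<longleftrightarrow> f x - \<kappa> \<in> (\<lambda>y. \<phi> (x @ y)) ` cube j \<and>
        (\<forall>v\<in>(\<lambda>y. \<phi> (x @ y)) ` cube j. f x - \<kappa> \<le> v)"
      by (rule Min_eq_iff) (auto simp: finite_cube cube_nonempty)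
    also have "\<dots> \<longleftrightarrow>
        (\<exists>y\<in>cube j. f x = \<phi> (x @ y) + \<kappa>) \<and> (\<forall>y\<in>cube j. f x \<le> \<phi> (x @ y) + \<kappa>)"
      by (auto simp: image_iff algebra_simps)
    finally show ?thesis .
  qed
  then show ?thesis
    unfolding expressible_def by simp
qed

lemma expressible_cong:
  assumes "expressible \<Gamma> n f" and "\<And>x. x \<in> cube n \<Longrightarrow> g x = f x"
  shows "expressible \<Gamma> n g"
  using assms unfolding expressible_def by simp

lemma expressible_Min:
  assumes "nonneg_combination \<Gamma> (n + j) \<phi>"
  shows "expressible \<Gamma> n (\<lambda>x. Min ((\<lambda>y. \<phi> (x @ y)) ` cube j))"
  unfolding expressible_def using assms by force

lemma expressible_nonneg_combination:
  assumes "nonneg_combination \<Gamma> n \<phi>"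
  shows "expressible \<Gamma> n \<phi>"
  using expressible_Min[of \<Gamma> n 0 \<phi>] assms by (simp add: cube_def)

lemma expressible_scale:
  assumes "expressible \<Gamma> n f" and "0 \<le> r"
  shows "expressible \<Gamma> n (\<lambda>x. r * f x)"
proof -
  obtain j \<kappa> \<phi> where \<phi>: "nonneg_combination \<Gamma> (n + j) \<phi>"
    and f: "\<forall>x\<in>cube n. f x = Min ((\<lambda>y. \<phi> (x @ y)) ` cube j) + \<kappa>"
    using assms(1) unfolding expressible_def by blast
  have "r * Min ((\<lambda>y. \<phi> (x @ y)) ` cube j) = Min ((\<lambda>y. r * \<phi> (x @ y)) ` cube j)" for x
    using mono_Min_commute[of "(*) r" "(\<lambda>y. \<phi> (x @ y)) ` cube j"] assms(2)
    by (simp add: monoI mult_left_mono finite_cube cube_nonempty image_image)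
  then have "\<forall>x\<in>cube n. r * f x = Min ((\<lambda>y. r * \<phi> (x @ y)) ` cube j) + r * \<kappa>"
    using f by (simp add: distrib_left)
  then show ?thesis
    using nonneg_combination_scale[OF \<phi> assms(2)] unfolding expressible_def by blast
qed

lemma nonneg_combination_add_hidden:
  assumes "nonneg_combination \<Gamma> (n + j) \<phi>" and "nonneg_combination \<Gamma> (n + j') \<phi>'"
  obtains \<Phi> where "nonneg_combination \<Gamma> (n + (j + j')) \<Phi>"
    and "\<And>x y y'. x \<in> cube n \<Longrightarrow> y \<in> cube j \<Longrightarrow> y' \<in> cube j' \<Longrightarrow>
      \<Phi> (x @ y @ y') = \<phi> (x @ y) + \<phi>' (x @ y')"
proof
  define \<rho> where "\<rho> i = (if i < n then i else i + j)" for i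
  let ?\<Phi> = "\<lambda>z. \<phi> (map (\<lambda>i. z ! i) [0..<n + j]) + \<phi>' (map (\<lambda>i. z ! \<rho> i) [0..<n + j'])"
  show "nonneg_combination \<Gamma> (n + (j + j')) ?\<Phi>"
    by (rule nonneg_combination_add; rule nonneg_combination_reindex)
      (use assms in \<open>auto simp: \<rho>_def\<close>)
  fix x y y' assume cubes: "x \<in> cube n" "y \<in> cube j" "y' \<in> cube j'"
  have "map (\<lambda>i. (x @ y @ y') ! i) [0..<n + j] = x @ y"
    using cubes by (intro nth_equalityI) (auto simp: cube_def nth_append)
  moreover have "map (\<lambda>i. (x @ y @ y') ! \<rho> i) [0..<n + j'] = x @ y'"
    using cubes by (intro nth_equalityI) (auto simp: cube_def nth_append \<rho>_def)
  ultimately show "?\<Phi> (x @ y @ y') = \<phi> (x @ y) + \<phi>' (x @ y')"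
    by simp
qed

lemma expressible_add:
  assumes "expressible \<Gamma> n f" and "expressible \<Gamma> n f'"
  shows "expressible \<Gamma> n (\<lambda>x. f x + f' x)"
proof -
  obtain j \<kappa> \<phi> where \<phi>: "nonneg_combination \<Gamma> (n + j) \<phi>"
    and f: "\<forall>x\<in>cube n. (\<exists>y\<in>cube j. f x = \<phi> (x @ y) + \<kappa>) \<and> (\<forall>y\<in>cube j. f x \<le> \<phi> (x @ y) + \<kappa>)"
    using assms(1) unfolding expressible_iff_attained by blast
  obtain j' \<kappa>' \<phi>' where \<phi>': "nonneg_combination \<Gamma> (n + j') \<phi>'"
    and f': "\<forall>x\<in>cube n. (\<exists>y\<in>cube j'. f' x = \<phi>' (x @ y) + \<kappa>') \<and>
      (\<forall>y\<in>cube j'. f' x \<le> \<phi>' (x @ y) + \<kappa>')"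
    using assms(2) unfolding expressible_iff_attained by blast
  obtain \<Phi> where comb: "nonneg_combination \<Gamma> (n + (j + j')) \<Phi>"
    and \<Phi>: "\<And>x y y'. x \<in> cube n \<Longrightarrow> y \<in> cube j \<Longrightarrow> y' \<in> cube j' \<Longrightarrow>
      \<Phi> (x @ y @ y') = \<phi> (x @ y) + \<phi>' (x @ y')"
    using nonneg_combination_add_hidden[OF \<phi> \<phi>'] by blast
  have "\<exists>w\<in>cube (j + j'). f x + f' x = \<Phi> (x @ w) + (\<kappa> + \<kappa>')" if x: "x \<in> cube n" for x
  proof -
    obtain y y' where "y \<in> cube j" "f x = \<phi> (x @ y) + \<kappa>" "y' \<in> cube j'" "f' x = \<phi>' (x @ y') + \<kappa>'"
      using x f f' by blast
    then show ?thesis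
      using x by (intro bexI[of _ "y @ y'"]) (simp_all add: \<Phi> append_in_cube)
  qed
  moreover have "f x + f' x \<le> \<Phi> (x @ w) + (\<kappa> + \<kappa>')"
    if x: "x \<in> cube n" and w: "w \<in> cube (j + j')" for x w
  proof -
    obtain y y' where "w = y @ y'" "y \<in> cube j" "y' \<in> cube j'"
      using that[of "take j w" "drop j w"] w by (simp add: cube_def)
    moreover from this have "f x \<le> \<phi> (x @ y) + \<kappa>" "f' x \<le> \<phi>' (x @ y') + \<kappa>'"
      using x f f' by blast+
    ultimately show ?thesis
      using x by (simp add: \<Phi>)
  qed
  ultimately show ?thesis
    using comb unfolding expressible_iff_attained by blast
qed

section \<open>Binary submodular functions\<close>

abbreviation coord :: "bool list \<Rightarrow> nat \<Rightarrow> real" where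
  "coord z i \<equiv> of_bool (z ! i)"

lemma cube_Suc: "cube (Suc n) = (\<Union>b. (#) b ` cube n)"
  by (auto simp: cube_def length_Suc_conv image_iff)

lemma cube_0: "cube 0 = {[]}"
  by (simp add: cube_def)

lemma Gamma_sub2_iff:
  "(n, g) \<in> Gamma_sub2 \<longleftrightarrow> n \<le> 2 \<and>
     (n = 2 \<longrightarrow> g [False, False] + g [True, True] \<le> g [False, True] + g [True, False])"
proof -
  have "submodular 0 g" "submodular 1 g"
    "submodular 2 g \<longleftrightarrow> g [False, False] + g [True, True] \<le> g [False, True] + g [True, False]"
    by (auto simp: submodular_def numeral_2_eq_2 cube_Suc cube_0 UNIV_bool)
  moreover have "n \<le> 2 \<longleftrightarrow> n = 0 \<or> n = 1 \<or> n = 2"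
    by auto
  ultimately show ?thesis
    unfolding Gamma_sub2_def by auto
qed

lemma nonneg_combination_scope:
  assumes "(length s, g) \<in> \<Gamma>" and "set s \<subseteq> {..<n}"
  shows "nonneg_combination \<Gamma> n (\<lambda>z. g (map ((!) z) s))"
  using nonneg_combination_insert[OF nonneg_combination_zero _ assms, of 1] by simp

lemma nonneg_combination_const: "nonneg_combination Gamma_sub2 n (\<lambda>z. r)"
  using nonneg_combination_scope[of "[]" "\<lambda>_. r" Gamma_sub2 n] by (simp add: Gamma_sub2_iff)

lemma nonneg_combination_linear:
  assumes "i < n"
  shows "nonneg_combination Gamma_sub2 n (\<lambda>z. r * coord z i)"
  using nonneg_combination_scope[of "[i]" "\<lambda>u. r * coord u 0" Gamma_sub2 n] assms
  by (simp add: Gamma_sub2_iff)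

lemma nonneg_combination_product:
  assumes "i < n" and "j < n" and "0 \<le> r"
  shows "nonneg_combination Gamma_sub2 n (\<lambda>z. - r * coord z i * coord z j)"
  using nonneg_combination_scope[of "[i, j]" "\<lambda>u. - r * coord u 0 * coord u 1" Gamma_sub2 n] assms
  by (simp add: Gamma_sub2_iff)

lemma expressible_two_thresholds:
  assumes "0 \<le> \<gamma>" and "\<And>i. i < n \<Longrightarrow> 0 \<le> c i" and "\<And>i. i < n \<Longrightarrow> 0 \<le> d i"
  shows "expressible Gamma_sub2 n (\<lambda>x.
    let C = \<Sum>i<n. c i * coord x i; D = \<Sum>i<n. d i * coord x i
    in min (min 0 (\<alpha> - C)) (min (\<beta> - D) (\<alpha> + \<beta> - \<gamma> - C - D)))"
proof -
  define C D where "C x = (\<Sum>i<n. c i * coord x i)" and "D x = (\<Sum>i<n. d i * coord x i)" for x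
  define \<phi> where "\<phi> z = \<alpha> * coord z n + \<beta> * coord z (n + 1) + - \<gamma> * coord z n * coord z (n + 1)
    + (\<Sum>i<n. - c i * coord z i * coord z n) + (\<Sum>i<n. - d i * coord z i * coord z (n + 1))" for z
  have "nonneg_combination Gamma_sub2 (n + 2) \<phi>"
    unfolding \<phi>_def using assms
    by (intro nonneg_combination_add nonneg_combination_linear nonneg_combination_product
        nonneg_combination_sum) auto
  then have minimum: "expressible Gamma_sub2 n (\<lambda>x. Min ((\<lambda>y. \<phi> (x @ y)) ` cube 2))"
    by (rule expressible_Min)
  have \<phi>: "\<phi> (x @ [v, w]) = (\<alpha> - C x) * of_bool v + (\<beta> - D x) * of_bool w
      - \<gamma> * of_bool v * of_bool w" if "x \<in> cube n" for x v w
    using that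
    by (simp add: \<phi>_def C_def D_def cube_def nth_append sum_distrib_right sum_negf
        left_diff_distrib)
  have cube_2: "cube 2 = {[False, False], [True, False], [False, True], [True, True]}"
    by (auto simp: numeral_2_eq_2 cube_Suc cube_0 UNIV_bool)
  show ?thesis
    unfolding Let_def C_def[symmetric] D_def[symmetric]
    by (rule expressible_cong[OF minimum]) (simp add: \<phi> cube_2 algebra_simps min.assoc)
qed

lemma expressible_threshold:
  assumes "\<And>i. i < n \<Longrightarrow> 0 \<le> c i"
  shows "expressible Gamma_sub2 n (\<lambda>x. min 0 (\<alpha> - (\<Sum>i<n. c i * coord x i)))"
  using expressible_two_thresholds[of 0 n c "\<lambda>_. 0" \<alpha> 0] assms by simp

section \<open>Expressible quartic functions\<close>

text \<open>The coefficient \<open>- q i j\<close> belongs to the pair complementary to \<open>{i, j}\<close>, and \<open>b i\<close> to the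
  triple omitting \<open>i\<close>, so that submodularity bounds \<open>q i j\<close> in terms of \<open>b i\<close> and \<open>b j\<close>. Only the
  values \<open>q i j\<close> with \<open>i < j\<close> matter.\<close>

definition quartic :: "(nat \<Rightarrow> nat \<Rightarrow> real) \<Rightarrow> (nat \<Rightarrow> real) \<Rightarrow> real \<Rightarrow> bool list \<Rightarrow> real" where
  "quartic q b A x = A * (\<Prod>k<4. coord x k) + (\<Sum>i<4. b i * (\<Prod>k\<in>{..<4}-{i}. coord x k))
     - (\<Sum>j<4. \<Sum>i<j. q i j * (\<Prod>k\<in>{..<4}-{i, j}. coord x k))"

abbreviation expressible_quartic :: "(nat \<Rightarrow> nat \<Rightarrow> real) \<Rightarrow> (nat \<Rightarrow> real) \<Rightarrow> real \<Rightarrow> bool" where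
  "expressible_quartic q b A \<equiv> expressible Gamma_sub2 4 (quartic q b A)"

lemma lessThan_4: "{..<4} = {0, 1, 2, 3 :: nat}"
  by auto

lemma less_4_iff: "m < 4 \<longleftrightarrow> m = 0 \<or> m = 1 \<or> m = 2 \<or> m = (3 :: nat)"
  by auto

lemma sum_lessThan_4: "(\<Sum>i<4::nat. h i) = h 0 + h 1 + h 2 + (h 3 :: 'a :: comm_monoid_add)"
  by (simp add: eval_nat_numeral)

lemma quartic_explicit:
  "quartic q b A x = A * coord x 0 * coord x 1 * coord x 2 * coord x 3
     + b 0 * coord x 1 * coord x 2 * coord x 3 + b 1 * coord x 0 * coord x 2 * coord x 3
     + b 2 * coord x 0 * coord x 1 * coord x 3 + b 3 * coord x 0 * coord x 1 * coord x 2
     - q 0 1 * coord x 2 * coord x 3 - q 0 2 * coord x 1 * coord x 3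
     - q 0 3 * coord x 1 * coord x 2 - q 1 2 * coord x 0 * coord x 3
     - q 1 3 * coord x 0 * coord x 2 - q 2 3 * coord x 0 * coord x 1"
proof -
  have "(\<Sum>j<4. \<Sum>i<j. h i j) = h 0 1 + h 0 2 + h 0 3 + h 1 2 + h 1 3 + h 2 3"
    for h :: "nat \<Rightarrow> nat \<Rightarrow> real"
    by (simp add: eval_nat_numeral)
  then have "quartic q b A x = A * (\<Prod>k<4. coord x k) + (\<Sum>i<4. b i * (\<Prod>k\<in>{..<4}-{i}. coord x k))
      - (\<Sum>(i, j)\<leftarrow>[(0, 1), (0, 2), (0, 3), (1, 2), (1, 3), (2, 3)].
          q i j * (\<Prod>k\<in>{..<4}-{i, j}. coord x k))"
    by (simp add: quartic_def)
  then show ?thesis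
    unfolding sum_lessThan_4
    by (simp add: lessThan_4 insert_Diff_if algebra_simps)
qed

lemma expressible_quartic_mono:
  assumes "expressible_quartic q b A"
    and "\<And>i j. i < j \<Longrightarrow> j < 4 \<Longrightarrow> q i j \<le> q' i j"
    and "\<And>i. i < 4 \<Longrightarrow> b' i = b i" and "A' = A"
  shows "expressible_quartic q' b' A'"
proof -
  define p where "p i j = q' i j - q i j" for i j
  have "0 \<le> p 0 1 \<and> 0 \<le> p 0 2 \<and> 0 \<le> p 0 3 \<and> 0 \<le> p 1 2 \<and> 0 \<le> p 1 3 \<and> 0 \<le> p 2 3"
    using assms(2) by (simp add: p_def)
  then have "nonneg_combination Gamma_sub2 4 (\<lambda>x. - p 0 1 * coord x 2 * coord x 3
      + - p 0 2 * coord x 1 * coord x 3 + - p 0 3 * coord x 1 * coord x 2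
      + - p 1 2 * coord x 0 * coord x 3 + - p 1 3 * coord x 0 * coord x 2
      + - p 2 3 * coord x 0 * coord x 1)"
    by (intro nonneg_combination_add nonneg_combination_product) simp_all
  from expressible_add[OF assms(1) expressible_nonneg_combination[OF this]] show ?thesis
    by (rule expressible_cong) (simp add: quartic_explicit assms(3,4) p_def algebra_simps)
qed

lemma expressible_quartic_add:
  assumes "expressible_quartic q b A" and "expressible_quartic q' b' A'"
  shows "expressible_quartic (\<lambda>i j. q i j + q' i j) (\<lambda>i. b i + b' i) (A + A')"
  using expressible_add[OF assms]
  by (rule expressible_cong) (simp add: quartic_explicit algebra_simps)

lemma expressible_quartic_scale:
  assumes "expressible_quartic q b A" and "0 \<le> r"
  shows "expressible_quartic (\<lambda>i j. r * q i j) (\<lambda>i. r * b i) (r * A)"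
  using expressible_scale[OF assms]
  by (rule expressible_cong) (simp add: quartic_explicit algebra_simps)

lemma expressible_quartic_eq_threshold:
  assumes "\<And>i. i < 4 \<Longrightarrow> 0 \<le> c i"
    and "\<And>x. quartic q b A x = min 0 (\<alpha> - (\<Sum>i<4. c i * coord x i))"
  shows "expressible_quartic q b A"
  by (rule expressible_cong[OF expressible_threshold[of 4 c \<alpha>]]) (simp_all only: assms)

lemma expressible_quartic_threshold_1: "expressible_quartic (\<lambda>i j. 1) (\<lambda>i. 1) (- 1)"
  by (rule expressible_quartic_eq_threshold[of "\<lambda>_. 1" _ _ _ 1])
    (auto simp: quartic_explicit sum_lessThan_4)

lemma expressible_quartic_threshold_2: "expressible_quartic (\<lambda>i j. 0) (\<lambda>i. - 1) 2"
  by (rule expressible_quartic_eq_threshold[of "\<lambda>_. 1" _ _ _ 2])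
    (auto simp: quartic_explicit sum_lessThan_4)

lemma expressible_quartic_threshold_3: "expressible_quartic (\<lambda>i j. 0) (\<lambda>i. 0) (- 1)"
  by (rule expressible_quartic_eq_threshold[of "\<lambda>_. 1" _ _ _ 3])
    (auto simp: quartic_explicit sum_lessThan_4)

lemma expressible_quartic_triple_threshold_1:
  assumes "m < 4"
  shows "expressible_quartic (\<lambda>i j. of_bool (m = i) + of_bool (m = j)) (\<lambda>i. of_bool (m = i)) 0"
proof (rule expressible_quartic_eq_threshold[of "\<lambda>i. of_bool (i \<noteq> m)" _ _ _ 1])
  show "quartic (\<lambda>i j. of_bool (m = i) + of_bool (m = j)) (\<lambda>i. of_bool (m = i)) 0 x
      = min 0 (1 - (\<Sum>i<4. of_bool (i \<noteq> m) * coord x i))" for x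
    using assms[unfolded less_4_iff] by (auto simp: quartic_explicit sum_lessThan_4)
qed simp

lemma expressible_quartic_triple_threshold_2:
  assumes "m < 4"
  shows "expressible_quartic (\<lambda>i j. 0) (\<lambda>i. - of_bool (m = i)) 0"
proof (rule expressible_quartic_eq_threshold[of "\<lambda>i. of_bool (i \<noteq> m)" _ _ _ 2])
  show "quartic (\<lambda>i j. 0) (\<lambda>i. - of_bool (m = i)) 0 x
      = min 0 (2 - (\<Sum>i<4. of_bool (i \<noteq> m) * coord x i))" for x
    using assms[unfolded less_4_iff] by (auto simp: quartic_explicit sum_lessThan_4)
qed simp

lemma expressible_quartic_sum:
  assumes "finite K" and "\<And>k. k \<in> K \<Longrightarrow> expressible_quartic (q k) (b k) (A k)"
  shows "expressible_quartic (\<lambda>i j. \<Sum>k\<in>K. q k i j) (\<lambda>i. \<Sum>k\<in>K. b k i) (\<Sum>k\<in>K. A k)"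
  using assms
proof (induction K)
  case empty
  have "expressible Gamma_sub2 4 (\<lambda>x. 0)"
    by (intro expressible_nonneg_combination nonneg_combination_zero)
  then show ?case
    by (rule expressible_cong) (simp add: quartic_explicit)
next
  case (insert k K)
  then show ?case
    using expressible_quartic_add[of "q k" "b k" "A k"] by simp
qed

lemma expressible_quartic_cubic:
  assumes "\<And>m. m < 4 \<Longrightarrow> 0 \<le> p m" and "\<And>m. m < 4 \<Longrightarrow> 0 \<le> r m"
  shows "expressible_quartic (\<lambda>i j. p i + p j) (\<lambda>i. p i - r i) 0"
proof -
  have "expressible_quartic (\<lambda>i j. \<Sum>m<4. p m * (of_bool (m = i) + of_bool (m = j)))
      (\<lambda>i. \<Sum>m<4. p m * of_bool (m = i)) (\<Sum>m<4. p m * 0)"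
    using assms(1) by (intro expressible_quartic_sum expressible_quartic_scale
        expressible_quartic_triple_threshold_1) auto
  moreover have "expressible_quartic (\<lambda>i j. \<Sum>m<4. r m * 0) (\<lambda>i. \<Sum>m<4. r m * - of_bool (m = i))
      (\<Sum>m<4. r m * 0)"
    using assms(2) by (intro expressible_quartic_sum expressible_quartic_scale
        expressible_quartic_triple_threshold_2) auto
  ultimately have "expressible_quartic
      (\<lambda>i j. (\<Sum>m<4. p m * (of_bool (m = i) + of_bool (m = j))) + (\<Sum>m<4. r m * 0))
      (\<lambda>i. (\<Sum>m<4. p m * of_bool (m = i)) + (\<Sum>m<4. r m * - of_bool (m = i)))
      ((\<Sum>m<4. p m * 0) + (\<Sum>m<4. r m * 0))"
    by (rule expressible_quartic_add)
  then show ?thesis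
    by (rule expressible_quartic_mono) (auto simp: sum_lessThan_4 less_4_iff)
qed

definition submodular_coeffs :: "(nat \<Rightarrow> nat \<Rightarrow> real) \<Rightarrow> (nat \<Rightarrow> real) \<Rightarrow> real \<Rightarrow> bool" where
  "submodular_coeffs q b A \<longleftrightarrow> (\<forall>i j. q i j = q j i) \<and>
     (\<forall>i<4. \<forall>j<4. i \<noteq> j \<longrightarrow> 0 \<le> q i j \<and> b i \<le> q i j \<and> b i + b j + A \<le> q i j)"

lemma submodular_coeffsD:
  assumes "submodular_coeffs q b A" and "i < 4" "j < 4" "i \<noteq> j"
  shows "0 \<le> q i j" and "b i \<le> q i j" and "b j \<le> q i j" and "b i + b j + A \<le> q i j"
  using assms unfolding submodular_coeffs_def by metis+

definition separated_coeffs :: "(nat \<Rightarrow> nat \<Rightarrow> real) \<Rightarrow> (nat \<Rightarrow> real) \<Rightarrow> bool" where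
  "separated_coeffs q b \<longleftrightarrow>
     (\<forall>i<4. \<forall>j<4. \<forall>k<4. \<forall>l<4. distinct [i, j, k, l] \<longrightarrow> b i + b j \<le> q i j + q k l)"

text \<open>The bounds on \<open>\<alpha>\<close>, the weight of \<open>- max 0 (\<Sum> x - 1)\<close>, are compared by exactly the
  submodularity and separation inequalities.\<close>

lemma separating_scale:
  assumes "A \<le> 0" and submodular: "submodular_coeffs q b A" and separated: "separated_coeffs q b"
  obtains \<alpha> where "0 \<le> \<alpha>" and "\<alpha> \<le> - A"
    and "\<And>i j. i < 4 \<Longrightarrow> j < 4 \<Longrightarrow> i \<noteq> j \<Longrightarrow> b i + b j - q i j \<le> \<alpha>"
    and "\<And>k l. k < 4 \<Longrightarrow> l < 4 \<Longrightarrow> k \<noteq> l \<Longrightarrow> \<alpha> \<le> q k l"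
proof
  define L where "L = insert 0 {b i + b j - q i j | i j. i < 4 \<and> j < 4 \<and> i \<noteq> j}"
  have "L \<subseteq> insert 0 ((\<lambda>(i, j). b i + b j - q i j) ` ({..<4} \<times> {..<4}))"
    by (auto simp: L_def)
  then have finite: "finite L"
    by (rule finite_subset) simp
  show "0 \<le> Max L"
    using finite by (simp add: L_def)
  show "b i + b j - q i j \<le> Max L" if "i < 4" "j < 4" "i \<noteq> j" for i j
    using finite by (rule Max_ge) (use that in \<open>unfold L_def, blast\<close>)
  have Max_le: "Max L \<le> v"
    if "0 \<le> v" "\<And>i j. i < 4 \<Longrightarrow> j < 4 \<Longrightarrow> i \<noteq> j \<Longrightarrow> b i + b j - q i j \<le> v" for v
    using finite that by (subst Max_le_iff) (auto simp: L_def)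
  show "Max L \<le> - A"
  proof (rule Max_le)
    show "b i + b j - q i j \<le> - A" if "i < 4" "j < 4" "i \<noteq> j" for i j
      using submodular_coeffsD(4)[OF submodular that] by simp
  qed (use assms(1) in simp)
  fix k l :: nat assume kl: "k < 4" "l < 4" "k \<noteq> l"
  show "Max L \<le> q k l"
  proof (rule Max_le)
    fix i j :: nat assume ij: "i < 4" "j < 4" "i \<noteq> j"
    show "b i + b j - q i j \<le> q k l"
    proof (cases "distinct [i, j, k, l]")
      case True
      then have "b i + b j \<le> q i j + q k l"
        using separated ij kl unfolding separated_coeffs_def by blast
      then show ?thesis by simp
    next
      case False
      then have "b i \<le> q k l \<or> b j \<le> q k l"
        using ij submodular_coeffsD(2,3)[OF submodular kl] kl(3) by auto
      then show ?thesis
        using submodular_coeffsD(2,3)[OF submodular ij] by auto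
    qed
  qed (rule submodular_coeffsD(1)[OF submodular kl])
qed

lemma expressible_quartic_nonpos:
  assumes "A \<le> 0" and submodular: "submodular_coeffs q b A" and "separated_coeffs q b"
  shows "expressible_quartic q b A"
proof -
  obtain \<alpha> where \<alpha>: "0 \<le> \<alpha>" "\<alpha> \<le> - A"
    and lower: "\<And>i j. i < 4 \<Longrightarrow> j < 4 \<Longrightarrow> i \<noteq> j \<Longrightarrow> b i + b j - q i j \<le> \<alpha>"
    and upper: "\<And>k l. k < 4 \<Longrightarrow> l < 4 \<Longrightarrow> k \<noteq> l \<Longrightarrow> \<alpha> \<le> q k l"
    using separating_scale[OF assms] by blast
  let ?p = "\<lambda>i. max 0 (b i - \<alpha>)" and ?r = "\<lambda>i. max 0 (\<alpha> - b i)"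
  have "expressible_quartic (\<lambda>i j. \<alpha> * 1 + (- A - \<alpha>) * 0 + (?p i + ?p j))
      (\<lambda>i. \<alpha> * 1 + (- A - \<alpha>) * 0 + (?p i - ?r i)) (\<alpha> * - 1 + (- A - \<alpha>) * - 1 + 0)"
    using \<alpha> by (intro expressible_quartic_add expressible_quartic_scale
        expressible_quartic_threshold_1 expressible_quartic_threshold_3 expressible_quartic_cubic)
      simp_all
  then show ?thesis
  proof (rule expressible_quartic_mono)
    fix i j :: nat assume "i < j" "j < 4"
    then have "i < 4" "j < 4" "i \<noteq> j" by simp_all
    note submodular_coeffsD[OF submodular this] lower[OF this] upper[OF this]
    then show "\<alpha> * 1 + (- A - \<alpha>) * 0 + (?p i + ?p j) \<le> q i j"
      by (auto simp: max_def)
  qed (simp_all add: max_def)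
qed

text \<open>The corners of the cube \<open>-1 \<le> b \<le> 0\<close> at \<open>A = 1\<close>, where \<open>q i j\<close> takes its least value
  \<open>max 0 (b i + b j + 1)\<close>.\<close>

abbreviation corner :: "nat set \<Rightarrow> bool list \<Rightarrow> real" where
  "corner E \<equiv> quartic (\<lambda>i j. of_bool (i \<in> E \<and> j \<in> E)) (\<lambda>i. of_bool (i \<in> E) - 1) 1"

lemma card_Int_lessThan_4:
  "card (E \<inter> {..<4 :: nat}) = of_bool (0 \<in> E) + of_bool (1 \<in> E) + of_bool (2 \<in> E) + of_bool (3 \<in> E)"
  by (simp add: lessThan_4)

lemma expressible_corner_empty:
  assumes "card (E \<inter> {..<4}) = 0"
  shows "expressible Gamma_sub2 4 (corner E)"
  by (rule expressible_quartic_mono[OF expressible_quartic_add[OF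
          expressible_quartic_threshold_2 expressible_quartic_threshold_3]])
    (use assms in auto)

lemma expressible_corner_singleton:
  assumes "card (E \<inter> {..<4}) = 1"
  shows "expressible Gamma_sub2 4 (corner E)"
proof (rule expressible_quartic_eq_threshold)
  show "corner E x = min 0 (3 - (\<Sum>i<4. (1 + of_bool (i \<in> E)) * coord x i))" for x
    using assms unfolding card_Int_lessThan_4 quartic_explicit sum_lessThan_4
    by (cases "0 \<in> E"; cases "1 \<in> E"; cases "2 \<in> E"; cases "3 \<in> E";
        cases "x ! 0"; cases "x ! 1"; cases "x ! 2"; cases "x ! 3"; simp)
qed simp

lemma expressible_corner_pair:
  assumes "card (E \<inter> {..<4}) = 2"
  shows "expressible Gamma_sub2 4 (corner E)"
proof (rule expressible_cong[OF expressible_two_thresholds])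
  consider "0 \<in> E" "1 \<in> E" "2 \<notin> E" "3 \<notin> E" | "0 \<in> E" "2 \<in> E" "1 \<notin> E" "3 \<notin> E"
    | "0 \<in> E" "3 \<in> E" "1 \<notin> E" "2 \<notin> E" | "1 \<in> E" "2 \<in> E" "0 \<notin> E" "3 \<notin> E"
    | "1 \<in> E" "3 \<in> E" "0 \<notin> E" "2 \<notin> E" | "2 \<in> E" "3 \<in> E" "0 \<notin> E" "1 \<notin> E"
    using assms unfolding card_Int_lessThan_4
    by (cases "0 \<in> E"; cases "1 \<in> E"; cases "2 \<in> E"; cases "3 \<in> E"; simp)
  then show "corner E x =
      (let C = \<Sum>i<4. of_bool (i \<notin> E) * coord x i; D = \<Sum>i<4. of_bool (i \<in> E) * coord x i
       in min (min 0 (1 - C)) (min (2 - D) (1 + 2 - 1 - C - D)))" for x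
    unfolding quartic_explicit sum_lessThan_4
    by cases (cases "x ! 0"; cases "x ! 1"; cases "x ! 2"; cases "x ! 3"; simp)+
qed simp_all

lemma expressible_corner_triple:
  assumes "card (E \<inter> {..<4}) = 3"
  shows "expressible Gamma_sub2 4 (corner E)"
proof (rule expressible_quartic_eq_threshold)
  show "corner E x = min 0 (2 - (\<Sum>i<4. (1 + of_bool (i \<notin> E)) * coord x i))" for x
    using assms unfolding card_Int_lessThan_4 quartic_explicit sum_lessThan_4
    by (cases "0 \<in> E"; cases "1 \<in> E"; cases "2 \<in> E"; cases "3 \<in> E";
        cases "x ! 0"; cases "x ! 1"; cases "x ! 2"; cases "x ! 3"; simp)
qed simp

lemma expressible_corner_full:
  assumes "card (E \<inter> {..<4}) = 4"
  shows "expressible Gamma_sub2 4 (corner E)"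
proof -
  have "i \<in> E" if "i < 4" for i
    using that assms card_subset_eq[of "{..<4}" "E \<inter> {..<4}"] by auto
  then show ?thesis
    by (intro expressible_quartic_mono[OF expressible_quartic_add[OF
            expressible_quartic_threshold_1 expressible_quartic_threshold_2]]) auto
qed

lemma expressible_corner: "expressible Gamma_sub2 4 (corner E)"
proof -
  have "card (E \<inter> {..<4}) \<le> 4"
    using card_mono[of "{..<4}" "E \<inter> {..<4}"] by simp
  then consider "card (E \<inter> {..<4}) = 0" | "card (E \<inter> {..<4}) = 1" | "card (E \<inter> {..<4}) = 2"
    | "card (E \<inter> {..<4}) = 3" | "card (E \<inter> {..<4}) = 4"
    by linarith
  then show ?thesis
    by cases (fact expressible_corner_empty expressible_corner_singleton expressible_corner_pair
        expressible_corner_triple expressible_corner_full)+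
qed

text \<open>In terms of \<open>u i = b i + A / 2\<close> and \<open>r = A / 2\<close>, the least admissible \<open>q i j\<close> is
  \<open>max 0 (u i + u j)\<close> as long as \<open>\<bar>u i\<bar> \<le> r\<close>.\<close>

abbreviation centred_quartic :: "(nat \<Rightarrow> real) \<Rightarrow> real \<Rightarrow> bool list \<Rightarrow> real" where
  "centred_quartic u r \<equiv> quartic (\<lambda>i j. max 0 (u i + u j)) (\<lambda>i. u i - r) (2 * r)"

lemma expressible_centred_sign_vector:
  assumes "\<And>i. i < 4 \<Longrightarrow> c i = - 1 \<or> c i = 1"
  shows "expressible Gamma_sub2 4 (centred_quartic c 1)"
proof -
  let ?E = "{i. c i = 1}"
  have "expressible_quartic (\<lambda>i j. 2 * of_bool (i \<in> ?E \<and> j \<in> ?E))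
      (\<lambda>i. 2 * (of_bool (i \<in> ?E) - 1)) (2 * 1)"
    by (intro expressible_quartic_scale expressible_corner) simp
  then show ?thesis
  proof (rule expressible_quartic_mono)
    fix i j :: nat assume "i < j" "j < 4"
    show "2 * of_bool (i \<in> ?E \<and> j \<in> ?E) \<le> max 0 (c i + c j)"
      by simp
  next
    fix i :: nat assume "i < 4"
    then show "c i - 1 = 2 * (of_bool (i \<in> ?E) - 1)"
      using assms[of i] by auto
  qed simp
qed

lemma at_most_two_zeros_cases:
  fixes v :: "nat \<Rightarrow> real"
  obtains (few_zeros) k where "\<And>i j. i < 4 \<Longrightarrow> j < 4 \<Longrightarrow> i \<noteq> j \<Longrightarrow> v i = 0 \<Longrightarrow> v j = 0 \<Longrightarrow> k \<in> {i, j}"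
    | (many_zeros) m where "\<And>i. i < 4 \<Longrightarrow> i \<noteq> m \<Longrightarrow> v i = 0"
proof -
  define Z where "Z = {i. i < 4 \<and> v i = 0}"
  show thesis
  proof (cases "card Z \<le> 2")
    case True
    define k where "k = (SOME k. k \<in> Z)"
    have "k \<in> {i, j}" if "i \<in> Z" "j \<in> Z" "i \<noteq> j" for i j
    proof -
      have "{i, j} = Z"
        using that True by (intro card_seteq) (auto simp: Z_def)
      then show ?thesis
        using someI[of "\<lambda>k. k \<in> Z" i] that unfolding k_def by blast
    qed
    then show thesis
      by (intro few_zeros[of k]) (simp_all add: Z_def)
  next
    case False
    have "card ({..<4} - Z) = 4 - card Z"
      by (subst card_Diff_subset) (auto simp: Z_def)
    then have "card ({..<4} - Z) = 0 \<or> card ({..<4} - Z) = 1"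
      using False by auto
    then obtain m where "{..<4} - Z \<subseteq> {m}"
      by (metis card_0_eq card_1_singletonE empty_subsetI finite_Diff finite_lessThan order.refl)
    then show thesis
      by (intro many_zeros[of m]) (auto simp: Z_def)
  qed
qed

text \<open>A vector with at most two zeros is the average of two sign vectors that fill in the zeros by
  opposite signs; two zeros are also filled in by opposite signs in each of them.\<close>

lemma expressible_centred_signed_vector:
  assumes "\<And>i. i < 4 \<Longrightarrow> v i = - 1 \<or> v i = 0 \<or> v i = 1"
  shows "expressible Gamma_sub2 4 (centred_quartic v 1)"
proof (cases v rule: at_most_two_zeros_cases)
  case (few_zeros k)
  define c where "c i = (if v i \<noteq> 0 then v i else if i = k then 1 else - 1)" for i
  let ?c' = "\<lambda>i. 2 * v i - c i"
  have "expressible_quartic (\<lambda>i j. 1 / 2 * max 0 (c i + c j) + 1 / 2 * max 0 (?c' i + ?c' j))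
      (\<lambda>i. 1 / 2 * (c i - 1) + 1 / 2 * (?c' i - 1)) (1 / 2 * (2 * 1) + 1 / 2 * (2 * 1))"
    by (intro expressible_quartic_add expressible_quartic_scale expressible_centred_sign_vector)
      (use assms in \<open>force simp: c_def\<close>)+
  then show ?thesis
  proof (rule expressible_quartic_mono)
    fix i j :: nat assume "i < j" "j < 4"
    then show "1 / 2 * max 0 (c i + c j) + 1 / 2 * max 0 (?c' i + ?c' j) \<le> max 0 (v i + v j)"
      using assms[of i] assms[of j] few_zeros[of i j] by (auto simp: c_def)
  qed (simp_all add: field_simps)
next
  case (many_zeros m)
  have "expressible_quartic (\<lambda>i j. 0 + (max 0 (v i) + max 0 (v j)))
      (\<lambda>i. - 1 + (max 0 (v i) - max 0 (- v i))) (2 + 0)"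
    by (intro expressible_quartic_add expressible_quartic_threshold_2 expressible_quartic_cubic)
      simp_all
  then show ?thesis
  proof (rule expressible_quartic_mono)
    fix i j :: nat assume "i < j" "j < 4"
    then have "v i = 0 \<or> v j = 0"
      using many_zeros[of i] many_zeros[of j] by auto
    then show "0 + (max 0 (v i) + max 0 (v j)) \<le> max 0 (v i + v j)"
      by auto
  qed (simp_all add: max_def)
qed

lemma expressible_centred_add_layer:
  assumes "expressible Gamma_sub2 4 (centred_quartic u r)" and "0 \<le> t"
    and v: "\<And>i. i < 4 \<Longrightarrow> v i = - 1 \<and> u i \<le> 0 \<or> v i = 0 \<and> u i = 0 \<or> v i = 1 \<and> 0 \<le> u i"
  shows "expressible Gamma_sub2 4 (centred_quartic (\<lambda>i. u i + t * v i) (r + t))"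
proof -
  have "expressible Gamma_sub2 4 (centred_quartic v 1)"
    using v by (intro expressible_centred_signed_vector) blast
  from expressible_quartic_add[OF assms(1) expressible_quartic_scale[OF this \<open>0 \<le> t\<close>]]
  show ?thesis
  proof (rule expressible_quartic_mono)
    fix i j :: nat assume "i < j" "j < 4"
    then show "max 0 (u i + u j) + t * max 0 (v i + v j) \<le> max 0 (u i + t * v i + (u j + t * v j))"
      using v[of i] v[of j] \<open>0 \<le> t\<close> by (auto simp: max_def)
  qed (simp_all add: algebra_simps)
qed

lemma smallest_layer:
  fixes u :: "'a \<Rightarrow> real"
  assumes "finite S" and "{i \<in> S. u i \<noteq> 0} \<noteq> {}"
  obtains t where "0 \<le> t" and "\<And>i. i \<in> S \<Longrightarrow> u i \<noteq> 0 \<Longrightarrow> t \<le> \<bar>u i\<bar>"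
    and "{i \<in> S. u i - t * sgn (u i) \<noteq> 0} \<subset> {i \<in> S. u i \<noteq> 0}"
proof
  define t where "t = Min ((\<lambda>i. \<bar>u i\<bar>) ` {i \<in> S. u i \<noteq> 0})"
  have "t \<in> (\<lambda>i. \<bar>u i\<bar>) ` {i \<in> S. u i \<noteq> 0}"
    unfolding t_def using assms by (intro Min_in) auto
  then obtain k where k: "k \<in> S" "u k \<noteq> 0" "t = \<bar>u k\<bar>"
    by auto
  then show "0 \<le> t"
    by simp
  show "t \<le> \<bar>u i\<bar>" if "i \<in> S" "u i \<noteq> 0" for i
    unfolding t_def using assms(1) that by (intro Min_le) auto
  have "u k - t * sgn (u k) = 0"
    by (simp add: k(3) abs_mult_sgn)
  then show "{i \<in> S. u i - t * sgn (u i) \<noteq> 0} \<subset> {i \<in> S. u i \<noteq> 0}"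
    using k(1,2) by auto
qed

text \<open>Layer-cake decomposition: \<open>u\<close> is peeled off in multiples of its sign vector, along which
  \<open>max 0 (u i + u j)\<close> is linear.\<close>

lemma expressible_centred:
  assumes "\<And>i. i < 4 \<Longrightarrow> \<bar>u i\<bar> \<le> r"
  shows "expressible Gamma_sub2 4 (centred_quartic u r)"
  using assms
proof (induction "card {i \<in> {..<4}. u i \<noteq> 0}" arbitrary: u r rule: less_induct)
  case less
  show ?case
  proof (cases "{i \<in> {..<4}. u i \<noteq> 0} = {}")
    case True
    have "0 \<le> r"
      using less.prems[of 0] by simp
    with expressible_quartic_threshold_2
    have "expressible_quartic (\<lambda>i j. r * 0) (\<lambda>i. r * - 1) (r * 2)"
      by (rule expressible_quartic_scale)
    then show ?thesis
      by (rule expressible_quartic_mono) (use True in auto)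
  next
    case False
    obtain t where "0 \<le> t" and t_le: "\<And>i. i \<in> {..<4} \<Longrightarrow> u i \<noteq> 0 \<Longrightarrow> t \<le> \<bar>u i\<bar>"
      and support: "{i \<in> {..<4}. u i - t * sgn (u i) \<noteq> 0} \<subset> {i \<in> {..<4}. u i \<noteq> 0}"
      using smallest_layer[OF finite_lessThan False] by blast
    define u' where "u' i = u i - t * sgn (u i)" for i
    have "card {i \<in> {..<4}. u' i \<noteq> 0} < card {i \<in> {..<4}. u i \<noteq> 0}"
      unfolding u'_def using support by (intro psubset_card_mono) simp_all
    moreover have "\<bar>u' i\<bar> \<le> r - t" if "i < 4" for i
    proof -
      have "t \<le> r"
        using False t_le less.prems by fastforce
      then show ?thesis
        using less.prems[OF that] t_le[of i] that by (auto simp: u'_def sgn_if split: if_splits)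
    qed
    ultimately have "expressible Gamma_sub2 4 (centred_quartic u' (r - t))"
      by (rule less.hyps)
    then have "expressible Gamma_sub2 4 (centred_quartic (\<lambda>i. u' i + t * sgn (u i)) (r - t + t))"
      using \<open>0 \<le> t\<close>
    proof (rule expressible_centred_add_layer)
      fix i :: nat assume "i < 4"
      then show "sgn (u i) = - 1 \<and> u' i \<le> 0 \<or> sgn (u i) = 0 \<and> u' i = 0 \<or> sgn (u i) = 1 \<and> 0 \<le> u' i"
        using t_le[of i] by (auto simp: u'_def sgn_if)
    qed
    then show ?thesis
      by (simp add: u'_def)
  qed
qed

lemma expressible_quartic_nonneg:
  assumes "0 \<le> A" and submodular: "submodular_coeffs q b A"
  shows "expressible_quartic q b A"
proof -
  define p r where "p i = max 0 (b i)" and "r i = max 0 (- A - b i)" for i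
  define u where "u i = b i - p i + r i + A / 2" for i
  have "expressible_quartic (\<lambda>i j. max 0 (u i + u j) + (p i + p j))
      (\<lambda>i. (u i - A / 2) + (p i - r i)) (2 * (A / 2) + 0)"
    using assms(1) by (intro expressible_quartic_add expressible_centred expressible_quartic_cubic)
      (auto simp: u_def p_def r_def max_def abs_if field_simps)
  then show ?thesis
  proof (rule expressible_quartic_mono)
    fix i j :: nat assume "i < j" "j < 4"
    then have "i < 4" "j < 4" "i \<noteq> j" by simp_all
    note submodular_coeffsD[OF submodular this]
    then show "max 0 (u i + u j) + (p i + p j) \<le> q i j"
      using assms(1) by (auto simp: u_def p_def r_def max_def)
  qed (simp_all add: u_def)
qed

section \<open>Multimorphisms\<close>

text \<open>Elements of \<open>{0,1}\<^sup>k\<close> and families of \<open>k\<close> rows are functions on all natural numbers, of which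
  only the values below \<open>k\<close> are relevant.\<close>

definition apply_columns ::
    "((nat \<Rightarrow> bool) \<Rightarrow> nat \<Rightarrow> bool) \<Rightarrow> nat \<Rightarrow> (nat \<Rightarrow> bool list) \<Rightarrow> nat \<Rightarrow> bool list" where
  "apply_columns F n X r = map (\<lambda>m. F (\<lambda>s. X s ! m) r) [0..<n]"

definition multimorphism ::
    "nat \<Rightarrow> ((nat \<Rightarrow> bool) \<Rightarrow> nat \<Rightarrow> bool) \<Rightarrow> nat \<Rightarrow> (bool list \<Rightarrow> real) \<Rightarrow> bool" where
  "multimorphism k F n \<phi> \<longleftrightarrow>
     (\<forall>X. range X \<subseteq> cube n \<longrightarrow> (\<Sum>r<k. \<phi> (apply_columns F n X r)) \<le> (\<Sum>r<k. \<phi> (X r)))"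

lemma apply_columns_in_cube: "apply_columns F n X r \<in> cube n"
  by (simp add: apply_columns_def cube_def)

lemma apply_columns_append:
  assumes "range X \<subseteq> cube n"
  shows "apply_columns F (n + m) (\<lambda>r. X r @ Y r) r = apply_columns F n X r @ apply_columns F m Y r"
proof (rule nth_equalityI)
  fix i assume i: "i < length (apply_columns F (n + m) (\<lambda>r. X r @ Y r) r)"
  have "length (X s) = n" for s
    using assms by (auto simp: cube_def)
  then show "apply_columns F (n + m) (\<lambda>r. X r @ Y r) r ! i
      = (apply_columns F n X r @ apply_columns F m Y r) ! i"
    using i by (auto simp: apply_columns_def nth_append)
qed (simp add: apply_columns_def)

lemma multimorphism_scope:
  assumes "multimorphism k F (length s) g" and "set s \<subseteq> {..<n}"
  shows "multimorphism k F n (\<lambda>z. g (map ((!) z) s))"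
  unfolding multimorphism_def
proof (intro allI impI)
  fix X :: "nat \<Rightarrow> bool list" assume "range X \<subseteq> cube n"
  define Y where "Y r = map ((!) (X r)) s" for r
  have "range Y \<subseteq> cube (length s)"
    by (auto simp: Y_def cube_def)
  then have "(\<Sum>r<k. g (apply_columns F (length s) Y r)) \<le> (\<Sum>r<k. g (Y r))"
    using assms(1) by (simp add: multimorphism_def)
  moreover have "apply_columns F (length s) Y r = map ((!) (apply_columns F n X r)) s" for r
    using assms(2) by (auto simp: apply_columns_def Y_def subset_eq intro!: nth_equalityI)
  ultimately show "(\<Sum>r<k. g (map ((!) (apply_columns F n X r)) s)) \<le> (\<Sum>r<k. g (map ((!) (X r)) s))"
    by (simp add: Y_def)
qed

lemma multimorphism_nonneg_combination:
  assumes "nonneg_combination \<Gamma> n \<phi>" and \<Gamma>: "\<And>m g. (m, g) \<in> \<Gamma> \<Longrightarrow> multimorphism k F m g"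
  shows "multimorphism k F n \<phi>"
  using assms(1)
proof (induction rule: nonneg_combination_induct)
  case (cong \<phi> \<psi>)
  then show ?case
    by (simp add: multimorphism_def apply_columns_in_cube image_subset_iff)
next
  case zero
  show ?case by (simp add: multimorphism_def)
next
  case (insert r s g \<psi>)
  have "multimorphism k F n (\<lambda>z. g (map ((!) z) s))"
    using \<Gamma>[OF insert(2)] insert(3) by (rule multimorphism_scope)
  then show ?case
    using insert(1,4)
    by (simp add: multimorphism_def sum.distrib add_mono mult_left_mono flip: sum_distrib_left)
qed

lemma multimorphism_expressible:
  assumes "expressible \<Gamma> n f" and \<Gamma>: "\<And>m g. (m, g) \<in> \<Gamma> \<Longrightarrow> multimorphism k F m g"
  shows "multimorphism k F n f"
  unfolding multimorphism_def
proof (intro allI impI)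
  fix X :: "nat \<Rightarrow> bool list" assume X: "range X \<subseteq> cube n"
  obtain j \<kappa> \<phi> where \<phi>: "nonneg_combination \<Gamma> (n + j) \<phi>"
    and attained: "\<forall>x\<in>cube n. \<exists>y\<in>cube j. f x = \<phi> (x @ y) + \<kappa>"
    and lower: "\<forall>x\<in>cube n. \<forall>y\<in>cube j. f x \<le> \<phi> (x @ y) + \<kappa>"
    using assms(1) unfolding expressible_iff_attained by blast
  have "\<forall>r. \<exists>y\<in>cube j. f (X r) = \<phi> (X r @ y) + \<kappa>"
    using attained X by blast
  then obtain Y where Y: "range Y \<subseteq> cube j" and f: "\<And>r. f (X r) = \<phi> (X r @ Y r) + \<kappa>"
    by (metis image_subsetI)
  have "f (apply_columns F n X r) \<le> \<phi> (apply_columns F (n + j) (\<lambda>r. X r @ Y r) r) + \<kappa>" for r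
    using lower by (simp add: apply_columns_append[OF X] apply_columns_in_cube)
  then have "(\<Sum>r<k. f (apply_columns F n X r))
      \<le> (\<Sum>r<k. \<phi> (apply_columns F (n + j) (\<lambda>r. X r @ Y r) r) + \<kappa>)"
    by (rule sum_mono)
  also have "\<dots> \<le> (\<Sum>r<k. \<phi> (X r @ Y r) + \<kappa>)"
  proof -
    have "multimorphism k F (n + j) \<phi>"
      using \<phi> \<Gamma> by (rule multimorphism_nonneg_combination)
    moreover have "range (\<lambda>r. X r @ Y r) \<subseteq> cube (n + j)"
      using X Y by (auto intro!: append_in_cube)
    ultimately show ?thesis
      by (simp add: multimorphism_def sum.distrib)
  qed
  finally show "(\<Sum>r<k. f (apply_columns F n X r)) \<le> (\<Sum>r<k. f (X r))"
    by (simp add: f)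
qed

text \<open>A binary submodular function is modular up to a term \<open>- t x y\<close> with \<open>t \<ge> 0\<close>, and \<open>F\<close> does not
  decrease inner products since \<open>F (inf z z') \<le> inf (F z) (F z')\<close>.\<close>

lemma sum_binary_submodular_le:
  fixes \<phi> :: "bool \<Rightarrow> bool \<Rightarrow> real" and F :: "(nat \<Rightarrow> bool) \<Rightarrow> nat \<Rightarrow> bool"
  assumes submodular: "\<phi> False False + \<phi> True True \<le> \<phi> False True + \<phi> True False"
    and "mono F" and weight: "\<And>z. (\<Sum>r<k. of_bool (F z r) :: real) = (\<Sum>r<k. of_bool (z r))"
  shows "(\<Sum>r<k. \<phi> (F z r) (F z' r)) \<le> (\<Sum>r<k. \<phi> (z r) (z' r))"
proof -
  define c p p' t where "c = \<phi> False False" and "p = \<phi> True False - \<phi> False False"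
    and "p' = \<phi> False True - \<phi> False False"
    and "t = \<phi> False True + \<phi> True False - \<phi> False False - \<phi> True True"
  have "\<phi> x y = c + p * of_bool x + p' * of_bool y - t * of_bool (x \<and> y)" for x y
    by (cases x; cases y; simp add: c_def p_def p'_def t_def)
  then have sum: "(\<Sum>r<k. \<phi> (z r) (z' r)) = (\<Sum>r<k. c) + p * (\<Sum>r<k. of_bool (z r))
      + p' * (\<Sum>r<k. of_bool (z' r)) - t * (\<Sum>r<k. of_bool (z r \<and> z' r))" for z z'
    by (simp only: sum.distrib sum_subtractf sum_distrib_left)
  have "(\<Sum>r<k. of_bool (z r \<and> z' r)) = (\<Sum>r<k. of_bool (F (inf z z') r) :: real)"
    by (simp only: weight inf_apply inf_bool_def)
  also have "\<dots> \<le> (\<Sum>r<k. of_bool (F z r \<and> F z' r))"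
    using mono_inf[OF \<open>mono F\<close>, of z z'] by (intro sum_mono) (auto simp: le_fun_def)
  finally have "t * (\<Sum>r<k. of_bool (z r \<and> z' r)) \<le> t * (\<Sum>r<k. of_bool (F z r \<and> F z' r))"
    using submodular by (intro mult_left_mono) (simp_all add: t_def)
  then show ?thesis
    unfolding sum weight by simp
qed

lemma multimorphism_Gamma_sub2:
  assumes "mono F" and weight: "\<And>z. (\<Sum>r<k. of_bool (F z r) :: real) = (\<Sum>r<k. of_bool (z r))"
    and "(n, g) \<in> Gamma_sub2"
  shows "multimorphism k F n g"
  unfolding multimorphism_def
proof (intro allI impI)
  fix X :: "nat \<Rightarrow> bool list" assume X: "range X \<subseteq> cube n"
  let ?g = "\<lambda>a b. g (take n [a, b])"
  have n: "n = 0 \<or> n = 1 \<or> n = 2"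
    using assms(3) by (auto simp: Gamma_sub2_iff)
  have "?g False False + ?g True True \<le> ?g False True + ?g True False"
    using n assms(3) by (auto simp: Gamma_sub2_iff)
  from sum_binary_submodular_le[OF this assms(1) weight]
  have "(\<Sum>r<k. ?g (F (\<lambda>s. X s ! 0) r) (F (\<lambda>s. X s ! 1) r)) \<le> (\<Sum>r<k. ?g (X r ! 0) (X r ! 1))" .
  moreover have "take n [X r ! 0, X r ! 1] = X r" for r
  proof -
    have "length (X r) = n"
      using X by (auto simp: cube_def)
    then show ?thesis
      using n by (auto simp: length_Suc_conv numeral_2_eq_2)
  qed
  moreover have "take n [F (\<lambda>s. X s ! 0) r, F (\<lambda>s. X s ! 1) r] = apply_columns F n X r" for r
    using n by (auto simp: apply_columns_def numeral_2_eq_2)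
  ultimately show "(\<Sum>r<k. g (apply_columns F n X r)) \<le> (\<Sum>r<k. g (X r))"
    by simp
qed

text \<open>Maps the columns of the rows \<open>ij, ik, jk, il, jl\<close> to those of the rows
  \<open>ijk, ijl, i, j, kl\<close>. It was found by computer search for an extension of this assignment
  that preserves weights and does not decrease inner products.\<close>

definition sep_map :: "(nat \<Rightarrow> bool) \<Rightarrow> nat \<Rightarrow> bool" where
  "sep_map z r \<longleftrightarrow>
     r = 0 \<and> (z 1 \<or> z 2 \<or> z 0 \<and> (z 3 \<or> z 4)) \<or>
     r = 1 \<and> (z 0 \<or> z 3 \<or> z 4) \<or>
     r = 2 \<and> z 0 \<and> z 1 \<and> z 3 \<or>
     r = 3 \<and> z 2 \<and> z 4 \<and> (z 0 \<or> z 1 \<and> z 3) \<or>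
     r = 4 \<and> (z 1 \<and> z 2 \<or> z 3 \<and> z 4 \<or> z 0 \<and> z 1 \<and> z 4 \<or> z 0 \<and> z 2 \<and> z 3)"

lemma sum_lessThan_5: "(\<Sum>r<5::nat. h r) = h 0 + h 1 + h 2 + h 3 + (h 4 :: 'a :: comm_monoid_add)"
  by (simp add: eval_nat_numeral)

lemma sep_map_weight: "(\<Sum>r<5. of_bool (sep_map z r) :: real) = (\<Sum>r<5. of_bool (z r))"
  unfolding sum_lessThan_5
  by (cases "z 0"; cases "z 1"; cases "z 2"; cases "z 3"; cases "z 4"; simp add: sep_map_def)

lemma mono_sep_map: "mono sep_map"
proof (intro monoI le_funI)
  fix z z' :: "nat \<Rightarrow> bool" and r assume "z \<le> z'"
  then have "z s \<longrightarrow> z' s" for s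
    by (auto dest: le_funD)
  then show "sep_map z r \<le> sep_map z' r"
    by (auto simp: sep_map_def)
qed

section \<open>Multilinear coefficients\<close>

definition indicator_list :: "nat \<Rightarrow> nat set \<Rightarrow> bool list" where
  "indicator_list n S = map (\<lambda>m. m \<in> S) [0..<n]"

lemma indicator_list_in_cube: "indicator_list n S \<in> cube n"
  by (simp add: indicator_list_def cube_def)

lemma polynomial_representation_indicator:
  assumes "polynomial_representation n a f" and "S \<subseteq> {..<n}"
  shows "f (indicator_list n S) = sum a (Pow S)"
proof -
  have "f (indicator_list n S)
      = (\<Sum>I\<in>Pow {..<n}. a I * (\<Prod>i\<in>I. of_bool (indicator_list n S ! i)))"
    using assms(1) indicator_list_in_cube unfolding polynomial_representation_def by blast
  also have "\<dots> = (\<Sum>I\<in>Pow {..<n}. if I \<subseteq> S then a I else 0)"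
  proof (rule sum.cong[OF refl])
    fix I assume I: "I \<in> Pow {..<n}"
    then have "(\<Prod>i\<in>I. of_bool (indicator_list n S ! i)) = (\<Prod>i\<in>I. of_bool (i \<in> S) :: real)"
      by (intro prod.cong) (auto simp: indicator_list_def)
    also have "\<dots> = of_bool (I \<subseteq> S)"
      using finite_subset[of I "{..<n}"] I by (auto simp: subset_eq)
    finally show "a I * (\<Prod>i\<in>I. of_bool (indicator_list n S ! i)) = (if I \<subseteq> S then a I else 0)"
      by simp
  qed
  also have "\<dots> = sum a (Pow S)"
    using assms(2) by (intro sum.mono_neutral_cong_right) auto
  finally show ?thesis .
qed

lemma sum_Pow_insert:
  fixes a :: "'a set \<Rightarrow> 'b :: comm_monoid_add"
  assumes "finite S" and "x \<notin> S"
  shows "sum a (Pow (insert x S)) = sum a (Pow S) + (\<Sum>I\<in>Pow S. a (insert x I))"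
proof -
  have "sum a (Pow (insert x S)) = sum a (Pow S) + sum a (insert x ` Pow S)"
    unfolding Pow_insert using assms by (intro sum.union_disjoint) auto
  also have "sum a (insert x ` Pow S) = (\<Sum>I\<in>Pow S. a (insert x I))"
    using assms(2) by (subst sum.reindex) (auto simp: inj_on_def)
  finally show ?thesis .
qed

lemma submodular_coefficient_sum_nonpos:
  assumes "submodular n f" and "polynomial_representation n a f"
    and S: "S \<subseteq> {..<n}" "i < n" "j < n" "i \<noteq> j" "i \<notin> S" "j \<notin> S"
  shows "(\<Sum>I\<in>Pow S. a (insert i (insert j I))) \<le> 0"
proof -
  let ?f = "\<lambda>S. f (indicator_list n S)"
  have "map2 min (indicator_list n (insert i S)) (indicator_list n (insert j S))
      = indicator_list n S"
    "map2 max (indicator_list n (insert i S)) (indicator_list n (insert j S))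
      = indicator_list n (insert i (insert j S))"
    using S by (auto simp: indicator_list_def list_eq_iff_nth_eq min_def max_def)
  then have "?f S + ?f (insert i (insert j S)) \<le> ?f (insert i S) + ?f (insert j S)"
    using assms(1) indicator_list_in_cube unfolding submodular_def by metis
  moreover have "finite S"
    using S(1) by (rule finite_subset) simp
  ultimately show ?thesis
    using S by (simp add: polynomial_representation_indicator[OF assms(2)] sum_Pow_insert)
qed

lemma lessThan_4_eq_distinct:
  assumes "i < 4" "j < 4" "k < 4" "l < 4" and "distinct [i, j, k, l]"
  shows "{..<4} = {i, j, k, l :: nat}"
  using assms by (intro card_subset_eq[symmetric]) auto

lemma sep_map_rows:
  assumes "distinct [i, j, k, l]" and "m \<in> {i, j, k, l}" and "r < 5"
  shows "sep_map (\<lambda>s. m \<in> [{i, j}, {i, k}, {j, k}, {i, l}, {j, l}] ! s) r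
    \<longleftrightarrow> m \<in> [{i, j, k}, {i, j, l}, {i}, {j}, {k, l}] ! r"
proof -
  have "r = 0 \<or> r = 1 \<or> r = 2 \<or> r = 3 \<or> r = 4"
    using assms(3) by linarith
  moreover have "m = i \<or> m = j \<or> m = k \<or> m = l"
    using assms(2) by simp
  ultimately show ?thesis
    using assms(1) by (elim disjE) (auto simp: sep_map_def)
qed

lemma expressible_imp_Sep:
  assumes "polynomial_representation 4 a f" and "expressible Gamma_sub2 4 f"
  shows "Sep a"
  unfolding Sep_def
proof (intro ballI impI)
  fix i j k l :: nat
  assume idx: "i \<in> {..<4}" "j \<in> {..<4}" "k \<in> {..<4}" "l \<in> {..<4}" and dist: "distinct [i, j, k, l]"
  define X where "X r = indicator_list 4 ([{i, j}, {i, k}, {j, k}, {i, l}, {j, l}] ! r)" for r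
  have "multimorphism 5 sep_map 4 f"
    using assms(2) multimorphism_Gamma_sub2[OF mono_sep_map sep_map_weight]
    by (rule multimorphism_expressible)
  moreover have "range X \<subseteq> cube 4"
    by (auto simp: X_def indicator_list_in_cube)
  ultimately have "(\<Sum>r<5. f (apply_columns sep_map 4 X r)) \<le> (\<Sum>r<5. f (X r))"
    by (simp add: multimorphism_def)
  moreover have "apply_columns sep_map 4 X r
      = indicator_list 4 ([{i, j, k}, {i, j, l}, {i}, {j}, {k, l}] ! r)" if "r < 5" for r
  proof -
    have "m \<in> {i, j, k, l}" if "m < 4" for m
      using that lessThan_4_eq_distinct[of i j k l] idx dist by (metis lessThan_iff)
    then show ?thesis
      using sep_map_rows[OF dist _ \<open>r < 5\<close>]
      by (simp add: apply_columns_def X_def indicator_list_def)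
  qed
  ultimately have "(\<Sum>S\<leftarrow>[{i, j, k}, {i, j, l}, {i}, {j}, {k, l}]. sum a (Pow S))
      \<le> (\<Sum>S\<leftarrow>[{i, j}, {i, k}, {j, k}, {i, l}, {j, l}]. sum a (Pow S))"
    using idx by (simp add: sum_lessThan_5 X_def polynomial_representation_indicator[OF assms(1)])
  then show "a {i, j} + a {k, l} + a {i, j, k} + a {i, j, l} \<le> 0"
    using dist by (simp add: sum_Pow_insert)
qed

definition pair_coeff :: "(nat set \<Rightarrow> real) \<Rightarrow> nat \<Rightarrow> nat \<Rightarrow> real" where
  "pair_coeff a i j = - a ({..<4} - {i, j})"

definition triple_coeff :: "(nat set \<Rightarrow> real) \<Rightarrow> nat \<Rightarrow> real" where
  "triple_coeff a i = a ({..<4} - {i})"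

lemma coeffs_distinct:
  assumes "i < 4" "j < 4" "k < 4" "l < 4" and "distinct [i, j, k, l]"
  shows "pair_coeff a i j = - a {k, l}" and "triple_coeff a i = a {k, l, j}"
    and "triple_coeff a j = a {k, l, i}" and "a {..<4} = a {k, l, i, j}"
  using assms(5) unfolding pair_coeff_def triple_coeff_def lessThan_4_eq_distinct[OF assms]
  by (auto intro!: arg_cong[of _ _ a])

lemma submodular_coeffs_representation:
  assumes "submodular 4 f" and "polynomial_representation 4 a f"
  shows "submodular_coeffs (pair_coeff a) (triple_coeff a) (a {..<4})"
  unfolding submodular_coeffs_def
proof (intro conjI allI impI)
  show "pair_coeff a i j = pair_coeff a j i" for i j
    by (simp add: pair_coeff_def insert_commute)
next
  fix i j :: nat assume ij: "i < 4" "j < 4" "i \<noteq> j"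
  then have "card ({..<4} - {i, j}) = 2"
    by simp
  then obtain k l where "{..<4} - {i, j} = {k, l}" "k \<noteq> l"
    by (meson card_2_iff)
  then have kl: "k < 4" "l < 4" "distinct [i, j, k, l]"
    using ij by auto
  have "(\<Sum>I\<in>Pow S. a (insert k (insert l I))) \<le> 0" if "S \<subseteq> {i, j}" for S
    using that kl ij by (intro submodular_coefficient_sum_nonpos[OF assms]) auto
  from this[of "{}"] this[of "{j}"] this[of "{i, j}"]
  have "a {k, l} \<le> 0" "a {k, l} + a {k, l, j} \<le> 0"
    "a {k, l} + a {k, l, j} + a {k, l, i} + a {k, l, i, j} \<le> 0"
    using kl by (simp_all add: sum_Pow_insert)
  then show "0 \<le> pair_coeff a i j" "triple_coeff a i \<le> pair_coeff a i j"
    "triple_coeff a i + triple_coeff a j + a {..<4} \<le> pair_coeff a i j"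
    by (simp_all add: coeffs_distinct[OF ij(1,2) kl])
qed

lemma Sep_imp_separated_coeffs:
  assumes "Sep a"
  shows "separated_coeffs (pair_coeff a) (triple_coeff a)"
  unfolding separated_coeffs_def
proof (intro allI impI)
  fix i j k l :: nat
  assume idx: "i < 4" "j < 4" "k < 4" "l < 4" and dist: "distinct [i, j, k, l]"
  have "a {k, l} + a {i, j} + a {k, l, i} + a {k, l, j} \<le> 0"
    using assms idx dist by (simp add: Sep_def)
  moreover have "pair_coeff a k l = - a {i, j}"
    using idx dist by (intro coeffs_distinct(1)) auto
  ultimately show "triple_coeff a i + triple_coeff a j \<le> pair_coeff a i j + pair_coeff a k l"
    by (simp add: coeffs_distinct[OF idx dist])
qed

lemma polynomial_representation_quartic:
  assumes "polynomial_representation 4 a f" and "x \<in> cube 4"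
  shows "f x = a {} + (\<Sum>i<4. a {i} * coord x i)
    + quartic (pair_coeff a) (triple_coeff a) (a {..<4}) x"
proof -
  have "f x = (\<Sum>I\<in>Pow {..<4}. a I * (\<Prod>i\<in>I. coord x i))"
    using assms unfolding polynomial_representation_def by blast
  then show ?thesis
    unfolding quartic_explicit sum_lessThan_4 pair_coeff_def triple_coeff_def lessThan_4
    by (simp add: sum_Pow_insert insert_Diff_if)
qed

lemma expressible_of_expressible_quartic:
  assumes "polynomial_representation 4 a f"
    and "expressible_quartic (pair_coeff a) (triple_coeff a) (a {..<4})"
  shows "expressible Gamma_sub2 4 f"
proof -
  have "expressible Gamma_sub2 4 (\<lambda>x. a {} + (\<Sum>i<4. a {i} * coord x i))"
    by (intro expressible_nonneg_combination nonneg_combination_add nonneg_combination_const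
        nonneg_combination_sum nonneg_combination_linear) auto
  from expressible_add[OF this assms(2)] show ?thesis
    by (rule expressible_cong) (rule polynomial_representation_quartic[OF assms(1)])
qed

theorem theorem4:
  fixes f :: "bool list \<Rightarrow> real" and a :: "nat set \<Rightarrow> real"
  assumes "submodular 4 f"
    and "polynomial_representation 4 a f"
  shows "expressible Gamma_sub2 4 f \<longleftrightarrow> Sep a"
proof
  assume "expressible Gamma_sub2 4 f"
  with assms(2) show "Sep a"
    by (rule expressible_imp_Sep)
next
  assume "Sep a"
  note submodular = submodular_coeffs_representation[OF assms]
    and separated = Sep_imp_separated_coeffs[OF \<open>Sep a\<close>]
  have "expressible_quartic (pair_coeff a) (triple_coeff a) (a {..<4})"
  proof (cases "0 \<le> a {..<4}")
    case True
    then show ?thesis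
      using submodular by (rule expressible_quartic_nonneg)
  next
    case False
    then show ?thesis
      using submodular separated by (intro expressible_quartic_nonpos) simp_all
  qed
  with assms(2) show "expressible Gamma_sub2 4 f"
    by (rule expressible_of_expressible_quartic)
qed

end
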